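(* Let $G$ be a 4-dimensional real Lie group with a left-invariant Riemannian metric $g$, and let $\{X,Y,Z,W\}$ be an orthonormal basis of its Lie algebra $\mathfrak g$ of left-invariant vector fields satisfying, for some real constants $\lambda,\alpha,\beta,a,b,r,z_1,z_2,z_3,z_4,w_1,w_2,\theta_1,\theta_2$, $$[W,Z]=\lambda W,$$ $$[Z,X]=\alpha X+\beta Y+z_1Z+w_1W,\qquad [Z,Y]=-\beta X+\alpha Y+z_2Z+w_2W,$$ $$[W,X]=aX+bY+z_3Z-z_1W,\qquad [W,Y]=-bX+aY+z_4Z-z_2W,$$ $$[Y,X]=rX+\theta_1Z+\theta_2W.$$ Let $J$ be the left-invariant almost complex structure on $G$ with $JX=Y$, $JY=-X$, $JZ=W$, $JW=-Z$. Then: (1) $J$ is integrable if and only if $2z_2+z_3+w_1=0$ and $2z_1-z_4-w_2=0$; (2) $J$ is almost Kähler if and only if $\theta_1-2a=0$ and $\theta_2+2\alpha=0$; (3) $J$ is Kähler if and only if $\theta_1-2a=\theta_2+2\alpha=0$ and $2z_2+z_3+w_1=2z_1-z_4-w_2=0$.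
   Context: The Kähler form of $(G,g,J)$ is the 2-form $\omega(E,F)=g(JE,F)$. $J$ is called almost Kähler if $d\omega=0$. $J$ is integrable if its Nijenhuis tensor $N_J(U,V)=[U,V]+J[JU,V]+J[U,JV]-[JU,JV]$ vanishes identically (equivalently, by the Newlander–Nirenberg theorem, $J$ comes from a complex manifold structure). $J$ is Kähler if it is both almost Kähler and integrable. The bracket relations are those arising when the left-invariant distribution spanned by $Z,W$ is tangent to a 2-dimensional left-invariant conformal foliation of $G$ with minimal leaves, and the orthonormal basis is chosen suitably. *)

theory Defs
  imports "HOL-Analysis.Analysis" "HOL-Library.Function_Algebras"
begin

instantiation "fun" :: (type, real_vector) real_vector
begin

definition scaleR_fun :: "real \<Rightarrow> ('a \<Rightarrow> 'b) \<Rightarrow> 'a \<Rightarrow> 'b"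
  where "scaleR_fun c f = (\<lambda>x. c *\<^sub>R f x)"

instance
  by standard (simp_all add: scaleR_fun_def fun_eq_iff algebra_simps)

end

text \<open>Only meant for open \<open>S\<close>, since the derivatives are taken at \<open>x\<close> rather than within \<open>S\<close>.\<close>

primrec Ck_on :: "nat \<Rightarrow> 'a::real_normed_vector set \<Rightarrow> ('a \<Rightarrow> 'b::real_normed_vector) \<Rightarrow> bool"
  where
    "Ck_on 0 S f \<longleftrightarrow> continuous_on S f"
  | "Ck_on (Suc k) S f \<longleftrightarrow>
       (\<forall>x\<in>S. f differentiable (at x)) \<and>
       (\<forall>v. Ck_on k S (\<lambda>x. frechet_derivative f (at x) v))"

definition smooth_on :: "'a::real_normed_vector set \<Rightarrow> ('a \<Rightarrow> 'b::real_normed_vector) \<Rightarrow> bool"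
  where "smooth_on S f \<longleftrightarrow> (\<forall>k. Ck_on k S f)"

text \<open>
  The underlying space is a whole type \<^typ>\<open>'g\<close>, assumed Hausdorff and second countable by its
  type classes. A chart is a pair of its domain and its coordinate map into the model space
  \<^typ>\<open>'e\<close>; the inverse chart is \<open>inv_into U \<phi>\<close>. Values of \<open>\<phi>\<close> outside \<open>U\<close> play no role.
\<close>

type_synonym ('g, 'e) atlas = "('g set \<times> ('g \<Rightarrow> 'e)) set"

definition smooth_atlas ::
    "('g::{t2_space, second_countable_topology}, 'e::euclidean_space) atlas \<Rightarrow> bool"
  where "smooth_atlas A \<longleftrightarrow>
    (\<forall>(U, \<phi>)\<in>A. open U \<and> open (\<phi> ` U) \<and> homeomorphism U (\<phi> ` U) \<phi> (inv_into U \<phi>)) \<and>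
    (\<Union>(U, \<phi>)\<in>A. U) = UNIV \<and>
    (\<forall>(U, \<phi>)\<in>A. \<forall>(V, \<psi>)\<in>A. smooth_on (\<phi> ` (U \<inter> V)) (\<psi> \<circ> inv_into U \<phi>))"

definition smooth_fun ::
    "('g, 'e::euclidean_space) atlas \<Rightarrow> ('g \<Rightarrow> real) \<Rightarrow> bool"
  where "smooth_fun A f \<longleftrightarrow> (\<forall>(U, \<phi>)\<in>A. smooth_on (\<phi> ` U) (f \<circ> inv_into U \<phi>))"

text \<open>
  Tangent vectors at \<open>p\<close> are the directional derivative operators on smooth functions, given in
  some chart around \<open>p\<close> by a direction \<open>\<xi>\<close> of the model space. By the chain rule the chart does
  not matter. An operator takes the value 0 on non-smooth functions, so that equality of
  operators means agreement on all smooth functions.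
\<close>

type_synonym 'g tvec = "('g \<Rightarrow> real) \<Rightarrow> real"

type_synonym 'g vfield = "'g \<Rightarrow> 'g tvec"

definition tangent_space ::
    "('g, 'e::euclidean_space) atlas \<Rightarrow> 'g \<Rightarrow> 'g tvec set"
  where "tangent_space A p =
    {v. \<exists>(U, \<phi>)\<in>A. p \<in> U \<and>
      (\<exists>\<xi>. v = (\<lambda>f. if smooth_fun A f
                 then frechet_derivative (f \<circ> inv_into U \<phi>) (at (\<phi> p)) \<xi> else 0))}"

definition vector_field ::
    "('g, 'e::euclidean_space) atlas \<Rightarrow> 'g vfield \<Rightarrow> bool"
  where "vector_field A V \<longleftrightarrow>
    (\<forall>p. V p \<in> tangent_space A p) \<and>
    (\<forall>f. smooth_fun A f \<longrightarrow> smooth_fun A (\<lambda>p. V p f))"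

definition bracket :: "'g vfield \<Rightarrow> 'g vfield \<Rightarrow> 'g vfield"
  where "bracket U V = (\<lambda>p f. U p (\<lambda>q. V q f) - V p (\<lambda>q. U q f))"

definition riemannian_metric ::
    "('g, 'e::euclidean_space) atlas \<Rightarrow> ('g \<Rightarrow> 'g tvec \<Rightarrow> 'g tvec \<Rightarrow> real) \<Rightarrow> bool"
  where "riemannian_metric A g \<longleftrightarrow>
    (\<forall>p. \<forall>u\<in>tangent_space A p. \<forall>v\<in>tangent_space A p. \<forall>w\<in>tangent_space A p. \<forall>c d.
       g p (c *\<^sub>R u + d *\<^sub>R v) w = c * g p u w + d * g p v w) \<and>
    (\<forall>p. \<forall>u\<in>tangent_space A p. \<forall>v\<in>tangent_space A p. g p u v = g p v u) \<and>
    (\<forall>p. \<forall>u\<in>tangent_space A p. u \<noteq> 0 \<longrightarrow> g p u u > 0) \<and>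
    (\<forall>U V. vector_field A U \<longrightarrow> vector_field A V \<longrightarrow> smooth_fun A (\<lambda>p. g p (U p) (V p)))"

definition almost_complex ::
    "('g, 'e::euclidean_space) atlas \<Rightarrow> ('g \<Rightarrow> 'g tvec \<Rightarrow> 'g tvec) \<Rightarrow> bool"
  where "almost_complex A J \<longleftrightarrow>
    (\<forall>p. \<forall>u\<in>tangent_space A p. J p u \<in> tangent_space A p) \<and>
    (\<forall>p. \<forall>u\<in>tangent_space A p. \<forall>v\<in>tangent_space A p. \<forall>c d.
       J p (c *\<^sub>R u + d *\<^sub>R v) = c *\<^sub>R J p u + d *\<^sub>R J p v) \<and>
    (\<forall>p. \<forall>u\<in>tangent_space A p. J p (J p u) = - u) \<and>
    (\<forall>V. vector_field A V \<longrightarrow> vector_field A (\<lambda>p. J p (V p)))"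

definition app_field :: "('g \<Rightarrow> 'g tvec \<Rightarrow> 'g tvec) \<Rightarrow> 'g vfield \<Rightarrow> 'g vfield"
  where "app_field J V = (\<lambda>p. J p (V p))"

definition nijenhuis ::
    "('g \<Rightarrow> 'g tvec \<Rightarrow> 'g tvec) \<Rightarrow> 'g vfield \<Rightarrow> 'g vfield \<Rightarrow> 'g vfield"
  where "nijenhuis J U V =
    bracket U V + app_field J (bracket (app_field J U) V)
      + app_field J (bracket U (app_field J V)) - bracket (app_field J U) (app_field J V)"

definition integrable_acs ::
    "('g, 'e::euclidean_space) atlas \<Rightarrow> ('g \<Rightarrow> 'g tvec \<Rightarrow> 'g tvec) \<Rightarrow> bool"
  where "integrable_acs A J \<longleftrightarrow>
    (\<forall>U V. vector_field A U \<longrightarrow> vector_field A V \<longrightarrow> nijenhuis J U V = 0)"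

definition kaehler_form ::
    "('g \<Rightarrow> 'g tvec \<Rightarrow> 'g tvec \<Rightarrow> real) \<Rightarrow> ('g \<Rightarrow> 'g tvec \<Rightarrow> 'g tvec)
      \<Rightarrow> 'g \<Rightarrow> 'g tvec \<Rightarrow> 'g tvec \<Rightarrow> real"
  where "kaehler_form g J = (\<lambda>p u v. g p (J p u) v)"

text \<open>The exterior derivative of a 2-form, by Cartan's invariant formula.\<close>

definition ext_deriv2 ::
    "('g \<Rightarrow> 'g tvec \<Rightarrow> 'g tvec \<Rightarrow> real) \<Rightarrow> 'g vfield \<Rightarrow> 'g vfield \<Rightarrow> 'g vfield \<Rightarrow> 'g \<Rightarrow> real"
  where "ext_deriv2 \<omega> U V W = (\<lambda>p.
    U p (\<lambda>q. \<omega> q (V q) (W q)) - V p (\<lambda>q. \<omega> q (U q) (W q)) + W p (\<lambda>q. \<omega> q (U q) (V q))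
    - \<omega> p (bracket U V p) (W p) + \<omega> p (bracket U W p) (V p) - \<omega> p (bracket V W p) (U p))"

definition almost_kaehler ::
    "('g, 'e::euclidean_space) atlas \<Rightarrow> ('g \<Rightarrow> 'g tvec \<Rightarrow> 'g tvec \<Rightarrow> real)
      \<Rightarrow> ('g \<Rightarrow> 'g tvec \<Rightarrow> 'g tvec) \<Rightarrow> bool"
  where "almost_kaehler A g J \<longleftrightarrow>
    (\<forall>U V W. vector_field A U \<longrightarrow> vector_field A V \<longrightarrow> vector_field A W \<longrightarrow>
       ext_deriv2 (kaehler_form g J) U V W = 0)"

definition kaehler ::
    "('g, 'e::euclidean_space) atlas \<Rightarrow> ('g \<Rightarrow> 'g tvec \<Rightarrow> 'g tvec \<Rightarrow> real)
      \<Rightarrow> ('g \<Rightarrow> 'g tvec \<Rightarrow> 'g tvec) \<Rightarrow> bool"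
  where "kaehler A g J \<longleftrightarrow> almost_kaehler A g J \<and> integrable_acs A J"

definition lie_group ::
    "('g::{t2_space, second_countable_topology}, 'e::euclidean_space) atlas
      \<Rightarrow> ('g \<Rightarrow> 'g \<Rightarrow> 'g) \<Rightarrow> 'g \<Rightarrow> ('g \<Rightarrow> 'g) \<Rightarrow> bool"
  where "lie_group A mul e minv \<longleftrightarrow>
    smooth_atlas A \<and> group mul e minv \<and>
    continuous_on UNIV (\<lambda>(x, y). mul x y) \<and> continuous_on UNIV minv \<and>
    (\<forall>(U, \<phi>)\<in>A. \<forall>(V, \<psi>)\<in>A. \<forall>(W, \<eta>)\<in>A.
       smooth_on {(s, t) \<in> \<phi> ` U \<times> \<psi> ` V. mul (inv_into U \<phi> s) (inv_into V \<psi> t) \<in> W}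
         (\<lambda>(s, t). \<eta> (mul (inv_into U \<phi> s) (inv_into V \<psi> t)))) \<and>
    (\<forall>(U, \<phi>)\<in>A. \<forall>(V, \<psi>)\<in>A.
       smooth_on {s \<in> \<phi> ` U. minv (inv_into U \<phi> s) \<in> V}
         (\<lambda>s. \<psi> (minv (inv_into U \<phi> s))))"

text \<open>The differential of left translation by \<open>a\<close>, taking tangent vectors at \<open>p\<close> to ones at \<open>a p\<close>.\<close>

definition dleft :: "('g \<Rightarrow> 'g \<Rightarrow> 'g) \<Rightarrow> 'g \<Rightarrow> 'g tvec \<Rightarrow> 'g tvec"
  where "dleft mul a v = (\<lambda>f. v (\<lambda>q. f (mul a q)))"

definition left_invariant_metric ::
    "('g, 'e::euclidean_space) atlas \<Rightarrow> ('g \<Rightarrow> 'g \<Rightarrow> 'g)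
      \<Rightarrow> ('g \<Rightarrow> 'g tvec \<Rightarrow> 'g tvec \<Rightarrow> real) \<Rightarrow> bool"
  where "left_invariant_metric A mul g \<longleftrightarrow>
    (\<forall>a p. \<forall>u\<in>tangent_space A p. \<forall>v\<in>tangent_space A p.
       g (mul a p) (dleft mul a u) (dleft mul a v) = g p u v)"

definition left_invariant_endo ::
    "('g, 'e::euclidean_space) atlas \<Rightarrow> ('g \<Rightarrow> 'g \<Rightarrow> 'g)
      \<Rightarrow> ('g \<Rightarrow> 'g tvec \<Rightarrow> 'g tvec) \<Rightarrow> bool"
  where "left_invariant_endo A mul J \<longleftrightarrow>
    (\<forall>a p. \<forall>u\<in>tangent_space A p. J (mul a p) (dleft mul a u) = dleft mul a (J p u))"

definition lie_algebra ::
    "('g, 'e::euclidean_space) atlas \<Rightarrow> ('g \<Rightarrow> 'g \<Rightarrow> 'g) \<Rightarrow> 'g vfield set"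
  where "lie_algebra A mul =
    {V. vector_field A V \<and> (\<forall>a p. V (mul a p) = dleft mul a (V p))}"

definition orthonormal_basis ::
    "('g \<Rightarrow> 'g tvec \<Rightarrow> 'g tvec \<Rightarrow> real) \<Rightarrow> 'g vfield set \<Rightarrow> 'g vfield list \<Rightarrow> bool"
  where "orthonormal_basis g L Es \<longleftrightarrow>
    independent (set Es) \<and> span (set Es) = L \<and>
    (\<forall>i<length Es. \<forall>j<length Es. \<forall>p. g p ((Es ! i) p) ((Es ! j) p) = (if i = j then 1 else 0))"

end

theory Submission
  imports Defs
begin

text \<open>
  All three equivalences rest on the fact that the Nijenhuis tensor and \<open>d\<omega>\<close> are tensors, so that
  they are determined by their values on the frame \<open>X, Y, Z, W\<close>, and those values can be read off
  from the bracket relations. The structure \<open>J\<close> pairs \<open>X\<close> with \<open>Y\<close> and \<open>Z\<close> with \<open>W\<close>, hence the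
  symmetries of \<open>N\<close> leave only \<open>N(X,Z)\<close>, which equals
  \<open>- (2 z1 - z4 - w2) Z - (2 z2 + z3 + w1) W\<close>. The two nonzero components of \<open>d\<omega>\<close> are
  \<open>d\<omega>(X,Y,W) = \<theta>1 - 2 a\<close> and \<open>d\<omega>(X,Y,Z) = - (\<theta>2 + 2 \<alpha>)\<close>.

  To pass from the frame to arbitrary vector fields, every vector field must be a combination of
  the frame with smooth coefficients. The frame is orthonormal at each point, so it is independent
  there; a tangent space is the image of the model space under a single chart and has dimension at
  most 4, so the frame spans it (\<open>tangent_space_eq_span\<close>, \<open>orthonormal_expansion\<close>). The
  coefficients are metric products with the frame and are therefore smooth
  (\<open>vector_field_cases\<close>).

  Tensoriality is not proved separately. Since tangent vectors are derivations, the bracket of two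
  combinations is an explicit combination involving the coefficients and their derivatives
  (\<open>bracket_comb\<close>). Substituting this into the definitions of \<open>N\<close> and \<open>d\<omega>\<close>, all derivative terms
  cancel identically and the formulas \<open>nijenhuis_comb\<close> and \<open>ext_deriv2_comb\<close> remain.
\<close>

section \<open>Algebra of smooth functions\<close>

text \<open>The derivatives at a point see a whole neighbourhood, hence the openness of \<open>S\<close>.\<close>

lemma Ck_on_cong:
  assumes "open S" "Ck_on k S f" "\<And>x. x \<in> S \<Longrightarrow> f x = g x"
  shows "Ck_on k S g"
  using assms(2,3)
proof (induction k arbitrary: f g)
  case 0
  then show ?case by (simp cong: continuous_on_cong)
next
  case (Suc k)
  have D: "(g has_derivative frechet_derivative f (at x)) (at x)" if "x \<in> S" for x
  proof (rule has_derivative_transform_within_open[OF _ assms(1) that Suc.prems(2)])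
    show "(f has_derivative frechet_derivative f (at x)) (at x)"
      using Suc.prems(1) that by (simp flip: frechet_derivative_works)
  qed
  have "frechet_derivative f (at x) = frechet_derivative g (at x)" if "x \<in> S" for x
    using frechet_derivative_at[OF D[OF that]] .
  then show ?case
    using Suc.prems(1) D Suc.IH[of "\<lambda>x. frechet_derivative f (at x) _"]
    by (auto simp: differentiable_def)
qed

lemma Ck_on_Suc_imp: "Ck_on (Suc k) S f \<Longrightarrow> Ck_on k S f"
proof (induction k arbitrary: f)
  case 0
  then show ?case
    by (auto intro!: differentiable_imp_continuous_on
        simp: differentiable_on_def differentiable_at_withinI)
next
  case (Suc k)
  then show ?case by (metis Ck_on.simps(2))
qed

lemma Ck_on_const: "Ck_on k S (\<lambda>_. c)"
  by (induction k arbitrary: c) auto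

lemma frechet_derivative_add:
  assumes "f differentiable (at x)" "g differentiable (at x)"
  shows "frechet_derivative (\<lambda>x. f x + g x) (at x) v =
    frechet_derivative f (at x) v + frechet_derivative g (at x) v"
proof -
  have "((\<lambda>x. f x + g x) has_derivative
      (\<lambda>v. frechet_derivative f (at x) v + frechet_derivative g (at x) v)) (at x)"
    using assms by (auto intro!: has_derivative_add simp flip: frechet_derivative_works)
  from frechet_derivative_at[OF this, symmetric] show ?thesis by simp
qed

lemma frechet_derivative_mult_real:
  fixes f g :: "'a::real_normed_vector \<Rightarrow> real"
  assumes "f differentiable (at x)" "g differentiable (at x)"
  shows "frechet_derivative (\<lambda>x. f x * g x) (at x) v =
    frechet_derivative f (at x) v * g x + f x * frechet_derivative g (at x) v"
proof -
  have "((\<lambda>x. f x * g x) has_derivative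
      (\<lambda>v. f x * frechet_derivative g (at x) v + frechet_derivative f (at x) v * g x)) (at x)"
    using assms by (auto intro!: has_derivative_mult simp flip: frechet_derivative_works)
  from frechet_derivative_at[OF this, symmetric] show ?thesis by simp
qed

lemma Ck_on_add:
  assumes "open S" "Ck_on k S f" "Ck_on k S g"
  shows "Ck_on k S (\<lambda>x. f x + g x)"
  using assms(2,3)
proof (induction k arbitrary: f g)
  case 0
  then show ?case by (auto intro: continuous_intros)
next
  case (Suc k)
  have "Ck_on k S (\<lambda>x. frechet_derivative (\<lambda>x. f x + g x) (at x) v)" for v
    by (rule Ck_on_cong[OF assms(1), where
          f = "\<lambda>x. frechet_derivative f (at x) v + frechet_derivative g (at x) v"])
      (use Suc in \<open>auto simp: frechet_derivative_add\<close>)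
  then show ?case using Suc.prems by auto
qed

text \<open>The product rule expresses the derivative through products of functions that are one order
  less regular, which is why the factors must also be known to be \<open>Ck_on k\<close>.\<close>

lemma Ck_on_mult:
  fixes f g :: "'a::real_normed_vector \<Rightarrow> real"
  assumes "open S" "Ck_on k S f" "Ck_on k S g"
  shows "Ck_on k S (\<lambda>x. f x * g x)"
  using assms(2,3)
proof (induction k arbitrary: f g)
  case 0
  then show ?case by (auto intro: continuous_intros)
next
  case (Suc k)
  have "Ck_on k S f" "Ck_on k S g"
    using Suc.prems Ck_on_Suc_imp by blast+
  then have "Ck_on k S (\<lambda>x. frechet_derivative f (at x) v * g x + f x * frechet_derivative g (at x) v)" for v
    using Suc by (auto intro!: Ck_on_add assms(1))
  then have "Ck_on k S (\<lambda>x. frechet_derivative (\<lambda>x. f x * g x) (at x) v)" for v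
    by (rule Ck_on_cong[OF assms(1)]) (use Suc.prems in \<open>auto simp: frechet_derivative_mult_real\<close>)
  then show ?case using Suc.prems by auto
qed

lemma smooth_fun_const: "smooth_fun A (\<lambda>_. c)"
  by (auto simp: smooth_fun_def smooth_on_def comp_def Ck_on_const)

lemma open_chart_image:
  assumes "smooth_atlas A" "(U, \<phi>) \<in> A"
  shows "open (\<phi> ` U)"
  using assms unfolding smooth_atlas_def by blast

lemma smooth_fun_add:
  assumes "smooth_atlas A" "smooth_fun A f" "smooth_fun A g"
  shows "smooth_fun A (\<lambda>p. f p + g p)"
  using assms(2,3) open_chart_image[OF assms(1)]
  by (auto simp: smooth_fun_def smooth_on_def comp_def intro!: Ck_on_add)

lemma smooth_fun_mult:
  assumes "smooth_atlas A" "smooth_fun A f" "smooth_fun A g"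
  shows "smooth_fun A (\<lambda>p. f p * g p)"
  using assms(2,3) open_chart_image[OF assms(1)]
  by (auto simp: smooth_fun_def smooth_on_def comp_def intro!: Ck_on_mult)

lemma smooth_fun_uminus:
  assumes "smooth_atlas A" "smooth_fun A f"
  shows "smooth_fun A (\<lambda>p. - f p)"
  using smooth_fun_mult[OF assms(1) smooth_fun_const[of _ "-1"] assms(2)] by simp

lemma smooth_fun_differentiable:
  assumes "smooth_atlas A" "smooth_fun A f" "(U, \<phi>) \<in> A" "p \<in> U"
  shows "(f \<circ> inv_into U \<phi>) differentiable (at (\<phi> p))"
proof -
  have "smooth_on (\<phi> ` U) (f \<circ> inv_into U \<phi>)"
    using assms unfolding smooth_fun_def by blast
  then have "Ck_on (Suc 0) (\<phi> ` U) (f \<circ> inv_into U \<phi>)"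
    unfolding smooth_on_def by blast
  then show ?thesis using assms(4) by simp
qed

section \<open>Tangent spaces\<close>

definition chart_tvec :: "('g, 'e::euclidean_space) atlas \<Rightarrow> 'g set \<Rightarrow> ('g \<Rightarrow> 'e) \<Rightarrow> 'g \<Rightarrow> 'e \<Rightarrow> 'g tvec"
  where "chart_tvec A U \<phi> p \<xi> = (\<lambda>f. if smooth_fun A f
    then frechet_derivative (f \<circ> inv_into U \<phi>) (at (\<phi> p)) \<xi> else 0)"

lemma tangent_space_cases:
  assumes "v \<in> tangent_space A p"
  obtains U \<phi> \<xi> where "(U, \<phi>) \<in> A" "p \<in> U" "v = chart_tvec A U \<phi> p \<xi>"
  using assms unfolding tangent_space_def chart_tvec_def by auto

lemma chart_tvec_in_tangent_space:
  assumes "(U, \<phi>) \<in> A" "p \<in> U"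
  shows "chart_tvec A U \<phi> p \<xi> \<in> tangent_space A p"
  using assms unfolding tangent_space_def chart_tvec_def by blast

lemma atlas_inv_into:
  assumes "smooth_atlas A" "(U, \<phi>) \<in> A" "p \<in> U"
  shows "inv_into U \<phi> (\<phi> p) = p"
proof -
  have "homeomorphism U (\<phi> ` U) \<phi> (inv_into U \<phi>)"
    using assms unfolding smooth_atlas_def by blast
  then show ?thesis using assms(3) by (simp add: homeomorphism_apply1)
qed

lemma open_chart_image_Int:
  assumes "smooth_atlas A" "(U, \<phi>) \<in> A" "(V, \<psi>) \<in> A"
  shows "open (\<psi> ` (U \<inter> V))"
proof -
  have V: "open V" "open (\<psi> ` V)" "homeomorphism V (\<psi> ` V) \<psi> (inv_into V \<psi>)" and U: "open U"
    using assms unfolding smooth_atlas_def by blast+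
  have "openin (top_of_set (\<psi> ` V)) (\<psi> ` (U \<inter> V))"
    by (rule homeomorphism_imp_open_map[OF V(3)]) (use U V(1) in \<open>auto simp: openin_open\<close>)
  then show ?thesis using V(2) openin_open_trans by blast
qed

text \<open>The chain rule: the transition map pushes the direction \<open>\<xi>\<close> forward from one chart to the other.
  Hence one chart around \<open>p\<close> already describes the whole tangent space, which makes the tangent
  space a linear image of the model space.\<close>

lemma chart_tvec_change:
  assumes A: "smooth_atlas A" and U: "(U, \<phi>) \<in> A" "p \<in> U" and V: "(V, \<psi>) \<in> A" "p \<in> V"
  shows "chart_tvec A V \<psi> p \<xi> =
    chart_tvec A U \<phi> p (frechet_derivative (\<phi> \<circ> inv_into V \<psi>) (at (\<psi> p)) \<xi>)"
proof -
  let ?t = "\<phi> \<circ> inv_into V \<psi>"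
  have tp: "?t (\<psi> p) = \<phi> p"
    using A V by (simp add: atlas_inv_into)
  have "smooth_on (\<psi> ` (V \<inter> U)) ?t"
    using A U(1) V(1) unfolding smooth_atlas_def by blast
  then have "Ck_on (Suc 0) (\<psi> ` (V \<inter> U)) ?t" unfolding smooth_on_def by blast
  then have t: "?t differentiable (at (\<psi> p))"
    using U(2) V(2) by auto
  have "frechet_derivative (f \<circ> inv_into V \<psi>) (at (\<psi> p)) =
      frechet_derivative (f \<circ> inv_into U \<phi>) (at (\<phi> p)) \<circ> frechet_derivative ?t (at (\<psi> p))"
    if f: "smooth_fun A f" for f
  proof -
    have "((f \<circ> inv_into U \<phi>) \<circ> ?t has_derivative
        frechet_derivative (f \<circ> inv_into U \<phi>) (at (\<phi> p)) \<circ> frechet_derivative ?t (at (\<psi> p))) (at (\<psi> p))"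
      using t smooth_fun_differentiable[OF A f U] tp
      by (intro diff_chain_at) (auto simp flip: frechet_derivative_works)
    moreover have "\<psi> p \<in> \<psi> ` (U \<inter> V)" using U(2) V(2) by blast
    moreover have "((f \<circ> inv_into U \<phi>) \<circ> ?t) x = (f \<circ> inv_into V \<psi>) x" if "x \<in> \<psi> ` (U \<inter> V)" for x
      using that A U V by (auto simp: atlas_inv_into)
    ultimately have "(f \<circ> inv_into V \<psi> has_derivative
        frechet_derivative (f \<circ> inv_into U \<phi>) (at (\<phi> p)) \<circ> frechet_derivative ?t (at (\<psi> p))) (at (\<psi> p))"
      using open_chart_image_Int[OF A U(1) V(1)] has_derivative_transform_within_open by blast
    from frechet_derivative_at[OF this] show ?thesis by simp
  qed
  then show ?thesis by (auto simp: chart_tvec_def)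
qed

lemma linear_chart_tvec:
  assumes "smooth_atlas A" "(U, \<phi>) \<in> A" "p \<in> U"
  shows "linear (chart_tvec A U \<phi> p)"
proof -
  have "linear (frechet_derivative (f \<circ> inv_into U \<phi>) (at (\<phi> p)))" if "smooth_fun A f" for f
    using linear_frechet_derivative[OF smooth_fun_differentiable[OF assms(1) that assms(2,3)]] .
  then show ?thesis
    by (intro linearI) (auto simp: chart_tvec_def fun_eq_iff scaleR_fun_def linear_add linear_scale)
qed

lemma tangent_space_eq_range:
  assumes "smooth_atlas A" "(U, \<phi>) \<in> A" "p \<in> U"
  shows "tangent_space A p = range (chart_tvec A U \<phi> p)"
  using chart_tvec_change[OF assms] chart_tvec_in_tangent_space[OF assms(2,3)]
  by (auto elim!: tangent_space_cases)

lemma chart_at: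
  assumes "smooth_atlas A"
  obtains U \<phi> where "(U, \<phi>) \<in> A" "p \<in> U"
  using assms unfolding smooth_atlas_def by blast

lemma subspace_tangent_space:
  assumes "smooth_atlas A"
  shows "subspace (tangent_space A p)"
proof -
  obtain U \<phi> where "(U, \<phi>) \<in> A" "p \<in> U" using assms by (rule chart_at)
  then show ?thesis
    using assms by (simp add: tangent_space_eq_range linear_chart_tvec linear_subspace_image)
qed

text \<open>The linear surjection from the model space bounds the dimension by \<open>DIM('e)\<close>, so an
  independent set that already has \<open>DIM('e)\<close> elements cannot be enlarged.\<close>

lemma tangent_space_eq_span:
  fixes A :: "('g::{t2_space, second_countable_topology}, 'e::euclidean_space) atlas"
  assumes A: "smooth_atlas A" and B: "B \<subseteq> tangent_space A p" "independent B" "card B = DIM('e)"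
  shows "tangent_space A p = span B"
proof
  show "span B \<subseteq> tangent_space A p"
    using B(1) subspace_tangent_space[OF A] by (rule span_minimal)
  obtain U \<phi> where U: "(U, \<phi>) \<in> A" "p \<in> U" using A by (rule chart_at)
  let ?L = "chart_tvec A U \<phi> p"
  have T: "tangent_space A p = span (?L ` Basis)"
    using linear_span_image[OF linear_chart_tvec[OF A U], of Basis]
    by (simp add: tangent_space_eq_range[OF A U])
  have finB: "finite B"
    using B(3) by (metis DIM_positive card.infinite less_numeral_extra(3))
  show "tangent_space A p \<subseteq> span B"
  proof (rule ccontr)
    assume "\<not> tangent_space A p \<subseteq> span B"
    then obtain v where v: "v \<in> tangent_space A p" "v \<notin> span B" by blast
    then have "independent (insert v B)" using B(2) by (simp add: independent_insertI)
    then have "card (insert v B) \<le> card (?L ` Basis)"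
      using independent_span_bound[of "?L ` Basis" "insert v B"] v(1) B(1) T by simp
    also have "\<dots> \<le> DIM('e)" by (rule card_image_le) simp
    finally show False
      using B(3) finB v(2) span_base[of v B] by (auto simp: card_insert_if split: if_splits)
  qed
qed

section \<open>Tangent vectors as derivations\<close>

lemma tvec_not_smooth: "v \<in> tangent_space A p \<Longrightarrow> \<not> smooth_fun A f \<Longrightarrow> v f = 0"
  by (auto elim!: tangent_space_cases simp: chart_tvec_def)

lemma tvec_const: "v \<in> tangent_space A p \<Longrightarrow> v (\<lambda>_. c) = 0"
  by (auto elim!: tangent_space_cases simp: chart_tvec_def comp_def frechet_derivative_const)

lemma tvec_add:
  assumes A: "smooth_atlas A" and v: "v \<in> tangent_space A p" and f: "smooth_fun A f" "smooth_fun A g"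
  shows "v (\<lambda>q. f q + g q) = v f + v g"
  using v
proof (cases rule: tangent_space_cases)
  case (1 U \<phi> \<xi>)
  note d = smooth_fun_differentiable[OF A _ 1(1,2)]
  show ?thesis
    using frechet_derivative_add[OF d[OF f(1)] d[OF f(2)]] f smooth_fun_add[OF A f]
    by (simp add: 1(3) chart_tvec_def comp_def)
qed

lemma tvec_mult:
  assumes A: "smooth_atlas A" and v: "v \<in> tangent_space A p" and f: "smooth_fun A f" "smooth_fun A g"
  shows "v (\<lambda>q. f q * g q) = v f * g p + f p * v g"
  using v
proof (cases rule: tangent_space_cases)
  case (1 U \<phi> \<xi>)
  note d = smooth_fun_differentiable[OF A _ 1(1,2)]
  show ?thesis
    using frechet_derivative_mult_real[OF d[OF f(1)] d[OF f(2)]] f smooth_fun_mult[OF A f]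
      atlas_inv_into[OF A 1(1,2)]
    by (simp add: 1(3) chart_tvec_def comp_def)
qed

lemma smooth_fun_diff:
  assumes "smooth_atlas A" "smooth_fun A f" "smooth_fun A g"
  shows "smooth_fun A (\<lambda>p. f p - g p)"
  using smooth_fun_add[OF assms(1,2) smooth_fun_uminus[OF assms(1,3)]] by simp

lemma tvec_uminus:
  assumes A: "smooth_atlas A" and v: "v \<in> tangent_space A p" and f: "smooth_fun A f"
  shows "v (\<lambda>q. - f q) = - v f"
  using tvec_mult[OF A v smooth_fun_const[of _ "-1"] f] tvec_const[OF v] by simp

lemma tvec_diff:
  assumes A: "smooth_atlas A" and v: "v \<in> tangent_space A p" and f: "smooth_fun A f" "smooth_fun A g"
  shows "v (\<lambda>q. f q - g q) = v f - v g"
  using tvec_add[OF A v f(1) smooth_fun_uminus[OF A f(2)]] tvec_uminus[OF A v f(2)] by simp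

section \<open>Orthonormal frames\<close>

lemma metric_sum_left:
  assumes A: "smooth_atlas A" and g: "riemannian_metric A g"
    and B: "finite B" "B \<subseteq> tangent_space A p" and w: "w \<in> tangent_space A p"
  shows "g p (\<Sum>b\<in>B. c b *\<^sub>R b) w = (\<Sum>b\<in>B. c b * g p b w)"
  using B
proof (induction B rule: finite_induct)
  case empty
  have "g p (0 *\<^sub>R w + 0 *\<^sub>R w) w = 0 * g p w w + 0 * g p w w"
    using g w unfolding riemannian_metric_def by blast
  then show ?case by (simp only: scaleR_zero_left add_0_left mult_zero_left sum.empty)
next
  case (insert b B)
  let ?s = "\<Sum>b\<in>B. c b *\<^sub>R b"
  have "?s \<in> tangent_space A p"
    using insert.prems subspace_tangent_space[OF A]
    by (intro subspace_sum subspace_scale) auto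
  then have "g p (c b *\<^sub>R b + 1 *\<^sub>R ?s) w = c b * g p b w + 1 * g p ?s w"
    using g w insert.prems unfolding riemannian_metric_def by blast
  then show ?case
    using insert by (simp only: sum.insert scaleR_one mult_1 insert_subset simp_thms)
qed

text \<open>Orthonormality turns the coefficients of any linear combination into metric products, so it
  gives independence; by the dimension count the vectors then also span.\<close>

lemma orthonormal_expansion:
  fixes A :: "('g::{t2_space, second_countable_topology}, 'e::euclidean_space) atlas"
  assumes A: "smooth_atlas A" and g: "riemannian_metric A g"
    and B: "B \<subseteq> tangent_space A p" "card B = DIM('e)"
    and on: "\<And>b c. b \<in> B \<Longrightarrow> c \<in> B \<Longrightarrow> g p b c = (if b = c then 1 else 0)"
    and v: "v \<in> tangent_space A p"
  shows "v = (\<Sum>b\<in>B. g p v b *\<^sub>R b)"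
proof -
  have finB: "finite B"
    using B(2) by (metis DIM_positive card.infinite less_numeral_extra(3))
  have coeff: "g p (\<Sum>b\<in>B. c b *\<^sub>R b) d = c d" if "d \<in> B" for c d
  proof -
    have "g p (\<Sum>b\<in>B. c b *\<^sub>R b) d = (\<Sum>b\<in>B. c b * g p b d)"
      using metric_sum_left[OF A g finB B(1)] B(1) that by blast
    also have "\<dots> = (\<Sum>b\<in>B. if b = d then c b else 0)"
      using that by (intro sum.cong) (auto simp: on)
    finally show ?thesis using that finB by simp
  qed
  have "independent B"
  proof
    assume "dependent B"
    then obtain c d where c: "(\<Sum>b\<in>B. c b *\<^sub>R b) = 0" and d: "d \<in> B" "c d \<noteq> 0"
      using dependent_finite[OF finB] by blast
    have "c d = g p 0 d" "0 = g p 0 d"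
      using coeff[OF d(1), of c] coeff[OF d(1), of "\<lambda>_. 0"] c by simp_all
    then show False using d(2) by simp
  qed
  then have "v \<in> span B"
    using tangent_space_eq_span[OF A B(1) _ B(2)] v by simp
  then obtain c where c: "v = (\<Sum>b\<in>B. c b *\<^sub>R b)"
    using finB by (auto simp: span_finite)
  then show ?thesis using coeff by simp
qed

locale orthonormal_frame =
  fixes A :: "('g::{t2_space, second_countable_topology}, real ^ 4) atlas"
    and g :: "'g \<Rightarrow> 'g tvec \<Rightarrow> 'g tvec \<Rightarrow> real"
    and X Y Z W :: "'g vfield"
  assumes atlas: "smooth_atlas A"
    and metric: "riemannian_metric A g"
    and vector_field_frame: "vector_field A X" "vector_field A Y" "vector_field A Z" "vector_field A W"
    and orthonormal: "i < 4 \<Longrightarrow> j < 4 \<Longrightarrow>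
      g p (([X, Y, Z, W] ! i) p) (([X, Y, Z, W] ! j) p) = (if i = j then 1 else 0)"
begin

lemma metric_frame [simp]:
  "g p (X p) (X p) = 1" "g p (X p) (Y p) = 0" "g p (X p) (Z p) = 0" "g p (X p) (W p) = 0"
  "g p (Y p) (X p) = 0" "g p (Y p) (Y p) = 1" "g p (Y p) (Z p) = 0" "g p (Y p) (W p) = 0"
  "g p (Z p) (X p) = 0" "g p (Z p) (Y p) = 0" "g p (Z p) (Z p) = 1" "g p (Z p) (W p) = 0"
  "g p (W p) (X p) = 0" "g p (W p) (Y p) = 0" "g p (W p) (Z p) = 0" "g p (W p) (W p) = 1"
  using orthonormal[of 0 0 p] orthonormal[of 0 1 p] orthonormal[of 0 2 p] orthonormal[of 0 3 p]
    orthonormal[of 1 0 p] orthonormal[of 1 1 p] orthonormal[of 1 2 p] orthonormal[of 1 3 p]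
    orthonormal[of 2 0 p] orthonormal[of 2 1 p] orthonormal[of 2 2 p] orthonormal[of 2 3 p]
    orthonormal[of 3 0 p] orthonormal[of 3 1 p] orthonormal[of 3 2 p] orthonormal[of 3 3 p]
  by simp_all

lemma frame_tangent:
  "X p \<in> tangent_space A p" "Y p \<in> tangent_space A p" "Z p \<in> tangent_space A p" "W p \<in> tangent_space A p"
  using vector_field_frame by (auto simp: vector_field_def)

definition comb :: "('g \<Rightarrow> real) \<Rightarrow> ('g \<Rightarrow> real) \<Rightarrow> ('g \<Rightarrow> real) \<Rightarrow> ('g \<Rightarrow> real) \<Rightarrow> 'g vfield"
  where "comb x y z w = (\<lambda>p. x p *\<^sub>R X p + y p *\<^sub>R Y p + z p *\<^sub>R Z p + w p *\<^sub>R W p)"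

lemma comb_apply: "comb x y z w p f = x p * X p f + y p * Y p f + z p * Z p f + w p * W p f"
  by (simp add: comb_def scaleR_fun_def)

lemma comb_tangent: "comb x y z w p \<in> tangent_space A p"
  unfolding comb_def
  by (intro subspace_add[OF subspace_tangent_space[OF atlas]]
      subspace_scale[OF subspace_tangent_space[OF atlas]] frame_tangent)

lemma comb_add:
  "comb x y z w + comb x' y' z' w' =
    comb (\<lambda>p. x p + x' p) (\<lambda>p. y p + y' p) (\<lambda>p. z p + z' p) (\<lambda>p. w p + w' p)"
  by (simp add: fun_eq_iff comb_apply algebra_simps)

lemma comb_diff:
  "comb x y z w - comb x' y' z' w' =
    comb (\<lambda>p. x p - x' p) (\<lambda>p. y p - y' p) (\<lambda>p. z p - z' p) (\<lambda>p. w p - w' p)"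
  by (simp add: fun_eq_iff comb_apply algebra_simps)

lemma comb_zero: "comb (\<lambda>_. 0) (\<lambda>_. 0) (\<lambda>_. 0) (\<lambda>_. 0) = 0"
  by (simp add: fun_eq_iff comb_apply)

lemma comb_cong:
  assumes "\<And>p. x p = x' p" "\<And>p. y p = y' p" "\<And>p. z p = z' p" "\<And>p. w p = w' p"
  shows "comb x y z w = comb x' y' z' w'"
  using assms by presburger

lemma metric_comb:
  assumes v: "v \<in> tangent_space A p"
  shows "g p (comb x y z w p) v = x p * g p (X p) v + y p * g p (Y p) v + z p * g p (Z p) v + w p * g p (W p) v"
proof -
  have lin: "g p (c *\<^sub>R s + d *\<^sub>R t) v = c * g p s v + d * g p t v"
    if "s \<in> tangent_space A p" "t \<in> tangent_space A p" for c d s t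
    using metric that v unfolding riemannian_metric_def by blast
  note sub = subspace_tangent_space[OF atlas, of p]
  have t: "x p *\<^sub>R X p + y p *\<^sub>R Y p \<in> tangent_space A p" "z p *\<^sub>R Z p + w p *\<^sub>R W p \<in> tangent_space A p"
    by (intro subspace_add[OF sub] subspace_scale[OF sub] frame_tangent)+
  have "comb x y z w p = 1 *\<^sub>R (x p *\<^sub>R X p + y p *\<^sub>R Y p) + 1 *\<^sub>R (z p *\<^sub>R Z p + w p *\<^sub>R W p)"
    unfolding comb_def scaleR_one add.assoc ..
  then have "g p (comb x y z w p) v = g p (x p *\<^sub>R X p + y p *\<^sub>R Y p) v + g p (z p *\<^sub>R Z p + w p *\<^sub>R W p) v"
    using lin[OF t, of 1 1] by (simp only: mult_1)
  then show ?thesis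
    by (simp only: lin[OF frame_tangent(1,2)] lin[OF frame_tangent(3,4)] add.assoc)
qed

lemma metric_sym:
  "s \<in> tangent_space A p \<Longrightarrow> t \<in> tangent_space A p \<Longrightarrow> g p s t = g p t s"
  using metric unfolding riemannian_metric_def by blast

lemma metric_comb_comb:
  "g p (comb x y z w p) (comb x' y' z' w' p) = x p * x' p + y p * y' p + z p * z' p + w p * w' p"
  by (simp add: metric_comb comb_tangent frame_tangent metric_sym[of _ p "comb x' y' z' w' p"])

lemma tangent_expansion:
  assumes v: "v \<in> tangent_space A p"
  shows "v = g p v (X p) *\<^sub>R X p + g p v (Y p) *\<^sub>R Y p + g p v (Z p) *\<^sub>R Z p + g p v (W p) *\<^sub>R W p"
proof -
  have d: "X p \<noteq> Y p" "X p \<noteq> Z p" "X p \<noteq> W p" "Y p \<noteq> Z p" "Y p \<noteq> W p" "Z p \<noteq> W p"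
    using metric_frame[of p] by (metis zero_neq_one)+
  let ?B = "{X p, Y p, Z p, W p}"
  have "v = (\<Sum>b\<in>?B. g p v b *\<^sub>R b)"
  proof (rule orthonormal_expansion[OF atlas metric _ _ _ v])
    show "?B \<subseteq> tangent_space A p" using frame_tangent by blast
    show "card ?B = DIM(real ^ 4)" using d by simp
    show "g p b c = (if b = c then 1 else 0)" if "b \<in> ?B" "c \<in> ?B" for b c
      using that d d[symmetric] by (elim insertE emptyE) simp_all
  qed
  also have "\<dots> = g p v (X p) *\<^sub>R X p + (g p v (Y p) *\<^sub>R Y p + (g p v (Z p) *\<^sub>R Z p + g p v (W p) *\<^sub>R W p))"
    using d by (simp only: sum.insert sum.empty finite.intros insert_iff empty_iff simp_thms add_0_right)
  finally show ?thesis by (simp only: add.assoc)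
qed

text \<open>The coefficients are metric products with the frame fields, and these are smooth because the
  metric is.\<close>

lemma vector_field_cases:
  assumes U: "vector_field A U"
  obtains x y z w where "smooth_fun A x" "smooth_fun A y" "smooth_fun A z" "smooth_fun A w"
    "U = comb x y z w"
proof
  show "smooth_fun A (\<lambda>p. g p (U p) (X p))" "smooth_fun A (\<lambda>p. g p (U p) (Y p))"
    "smooth_fun A (\<lambda>p. g p (U p) (Z p))" "smooth_fun A (\<lambda>p. g p (U p) (W p))"
    using metric U vector_field_frame unfolding riemannian_metric_def by blast+
  show "U = comb (\<lambda>p. g p (U p) (X p)) (\<lambda>p. g p (U p) (Y p)) (\<lambda>p. g p (U p) (Z p)) (\<lambda>p. g p (U p) (W p))"
    unfolding comb_def
  proof
    fix p
    have "U p \<in> tangent_space A p" using U by (simp add: vector_field_def)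
    then show "U p = g p (U p) (X p) *\<^sub>R X p + g p (U p) (Y p) *\<^sub>R Y p
        + g p (U p) (Z p) *\<^sub>R Z p + g p (U p) (W p) *\<^sub>R W p"
      by (rule tangent_expansion)
  qed
qed

lemma frame_as_comb:
  "X = comb (\<lambda>_. 1) (\<lambda>_. 0) (\<lambda>_. 0) (\<lambda>_. 0)" "Y = comb (\<lambda>_. 0) (\<lambda>_. 1) (\<lambda>_. 0) (\<lambda>_. 0)"
  "Z = comb (\<lambda>_. 0) (\<lambda>_. 0) (\<lambda>_. 1) (\<lambda>_. 0)" "W = comb (\<lambda>_. 0) (\<lambda>_. 0) (\<lambda>_. 0) (\<lambda>_. 1)"
  by (simp_all add: fun_eq_iff comb_apply)

lemma smooth_frame:
  assumes "smooth_fun A f"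
  shows "smooth_fun A (\<lambda>q. X q f)" "smooth_fun A (\<lambda>q. Y q f)"
    "smooth_fun A (\<lambda>q. Z q f)" "smooth_fun A (\<lambda>q. W q f)"
  using assms vector_field_frame unfolding vector_field_def by blast+

text \<open>The derivative of \<open>V f\<close> along \<open>U\<close> splits by the Leibniz rule into first-order terms, which
  give the derivatives of the coefficients, and second-order terms \<open>u\<^sub>i v\<^sub>j E\<^sub>i (E\<^sub>j f)\<close>, whose
  antisymmetrization gives the brackets of the frame. On a function that is not smooth both sides
  vanish.\<close>

lemma bracket_comb:
  fixes p :: 'g and f :: "'g \<Rightarrow> real"
  assumes u: "smooth_fun A u1" "smooth_fun A u2" "smooth_fun A u3" "smooth_fun A u4"
    and v: "smooth_fun A v1" "smooth_fun A v2" "smooth_fun A v3" "smooth_fun A v4"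
    and U: "U = comb u1 u2 u3 u4" and V: "V = comb v1 v2 v3 v4"
  shows "bracket U V p f =
    (U p v1 - V p u1) * X p f + (U p v2 - V p u2) * Y p f
    + (U p v3 - V p u3) * Z p f + (U p v4 - V p u4) * W p f
    - (u1 p * v2 p - u2 p * v1 p) * bracket Y X p f - (u1 p * v3 p - u3 p * v1 p) * bracket Z X p f
    - (u1 p * v4 p - u4 p * v1 p) * bracket W X p f - (u2 p * v3 p - u3 p * v2 p) * bracket Z Y p f
    - (u2 p * v4 p - u4 p * v2 p) * bracket W Y p f - (u3 p * v4 p - u4 p * v3 p) * bracket W Z p f"
proof (cases "smooth_fun A f")
  case False
  then show ?thesis
    by (simp add: bracket_def U V tvec_not_smooth[OF comb_tangent] tvec_const[OF comb_tangent]
        tvec_not_smooth[OF frame_tangent(1)] tvec_not_smooth[OF frame_tangent(2)]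
        tvec_not_smooth[OF frame_tangent(3)] tvec_not_smooth[OF frame_tangent(4)]
        tvec_const[OF frame_tangent(1)] tvec_const[OF frame_tangent(2)]
        tvec_const[OF frame_tangent(3)] tvec_const[OF frame_tangent(4)])
next
  case True
  note f = smooth_frame[OF True]
  have *: "comb x y z w p (\<lambda>q. comb x' y' z' w' q f) =
      comb x y z w p x' * X p f + comb x y z w p y' * Y p f
      + comb x y z w p z' * Z p f + comb x y z w p w' * W p f
      + x' p * comb x y z w p (\<lambda>q. X q f) + y' p * comb x y z w p (\<lambda>q. Y q f)
      + z' p * comb x y z w p (\<lambda>q. Z q f) + w' p * comb x y z w p (\<lambda>q. W q f)"
    if "smooth_fun A x'" "smooth_fun A y'" "smooth_fun A z'" "smooth_fun A w'" for x y z w x' y' z' w'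
    unfolding comb_apply[of x' y' z' w']
    by (simp add: tvec_add[OF atlas comb_tangent] tvec_mult[OF atlas comb_tangent]
        smooth_fun_add[OF atlas] smooth_fun_mult[OF atlas] that f)
  show ?thesis
    unfolding bracket_def U V *[OF u] *[OF v]
    unfolding comb_apply[of _ _ _ _ _ "\<lambda>q. _ q f"]
    by algebra
qed

end

section \<open>Nijenhuis tensor and Kaehler form in the frame\<close>

locale lie_frame = orthonormal_frame A g X Y Z W
  for A :: "('g::{t2_space, second_countable_topology}, real ^ 4) atlas"
    and g :: "'g \<Rightarrow> 'g tvec \<Rightarrow> 'g tvec \<Rightarrow> real"
    and X Y Z W :: "'g vfield" +
  fixes J :: "'g \<Rightarrow> 'g tvec \<Rightarrow> 'g tvec"
    and lam \<alpha> \<beta> a b r z1 z2 z3 z4 w1 w2 \<theta>1 \<theta>2 :: real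
  assumes bracket_frame:
    "bracket W Z = lam *\<^sub>R W"
    "bracket Z X = \<alpha> *\<^sub>R X + \<beta> *\<^sub>R Y + z1 *\<^sub>R Z + w1 *\<^sub>R W"
    "bracket Z Y = - \<beta> *\<^sub>R X + \<alpha> *\<^sub>R Y + z2 *\<^sub>R Z + w2 *\<^sub>R W"
    "bracket W X = a *\<^sub>R X + b *\<^sub>R Y + z3 *\<^sub>R Z - z1 *\<^sub>R W"
    "bracket W Y = - b *\<^sub>R X + a *\<^sub>R Y + z4 *\<^sub>R Z - z2 *\<^sub>R W"
    "bracket Y X = r *\<^sub>R X + \<theta>1 *\<^sub>R Z + \<theta>2 *\<^sub>R W"
    and almost_complex: "almost_complex A J"
    and J_frame: "app_field J X = Y" "app_field J Y = - X" "app_field J Z = W" "app_field J W = - Z"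
begin

lemma J_comb: "app_field J (comb x y z w) = comb (\<lambda>p. - y p) x (\<lambda>p. - w p) z"
proof (rule ext)
  fix p
  have lin: "J p (c *\<^sub>R s + d *\<^sub>R t) = c *\<^sub>R J p s + d *\<^sub>R J p t"
    if "s \<in> tangent_space A p" "t \<in> tangent_space A p" for c d s t
    using almost_complex that unfolding almost_complex_def by blast
  note sub = subspace_tangent_space[OF atlas, of p]
  have t: "x p *\<^sub>R X p + y p *\<^sub>R Y p \<in> tangent_space A p" "z p *\<^sub>R Z p + w p *\<^sub>R W p \<in> tangent_space A p"
    by (intro subspace_add[OF sub] subspace_scale[OF sub] frame_tangent)+
  have J: "J p (X p) = Y p" "J p (Y p) = - X p" "J p (Z p) = W p" "J p (W p) = - Z p"
    using J_frame[THEN fun_cong, of p] by (simp_all add: app_field_def)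
  have "comb x y z w p = 1 *\<^sub>R (x p *\<^sub>R X p + y p *\<^sub>R Y p) + 1 *\<^sub>R (z p *\<^sub>R Z p + w p *\<^sub>R W p)"
    unfolding comb_def scaleR_one add.assoc ..
  then have "J p (comb x y z w p) = J p (x p *\<^sub>R X p + y p *\<^sub>R Y p) + J p (z p *\<^sub>R Z p + w p *\<^sub>R W p)"
    using lin[OF t, of 1 1] by (simp only: scaleR_one)
  also have "\<dots> = (x p *\<^sub>R Y p + y p *\<^sub>R - X p) + (z p *\<^sub>R W p + w p *\<^sub>R - Z p)"
    by (simp only: lin[OF frame_tangent(1,2)] lin[OF frame_tangent(3,4)] J)
  also have "\<dots> = comb (\<lambda>p. - y p) x (\<lambda>p. - w p) z p"
    by (rule ext) (simp add: comb_apply scaleR_fun_def)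
  finally show "app_field J (comb x y z w) p = comb (\<lambda>p. - y p) x (\<lambda>p. - w p) z p"
    by (simp add: app_field_def)
qed

lemma kaehler_form_comb:
  "kaehler_form g J p (comb x y z w p) (comb x' y' z' w' p) =
    x p * y' p - y p * x' p + (z p * w' p - w p * z' p)"
proof -
  have "J p (comb x y z w p) = comb (\<lambda>p. - y p) x (\<lambda>p. - w p) z p"
    using J_comb[THEN fun_cong, of x y z w p] by (simp add: app_field_def)
  then show ?thesis by (simp add: kaehler_form_def metric_comb_comb)
qed

text \<open>The derivatives \<open>U p v1\<close> and the like, of the coefficients along the fields themselves are left
  unexpanded: in the tensors below they cancel formally, for arbitrary values.\<close>

lemma bracket_comb_structure_constants:
  assumes u: "smooth_fun A u1" "smooth_fun A u2" "smooth_fun A u3" "smooth_fun A u4"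
    and v: "smooth_fun A v1" "smooth_fun A v2" "smooth_fun A v3" "smooth_fun A v4"
    and U: "U = comb u1 u2 u3 u4" and V: "V = comb v1 v2 v3 v4"
  defines "m12 \<equiv> \<lambda>p. u1 p * v2 p - u2 p * v1 p" and "m13 \<equiv> \<lambda>p. u1 p * v3 p - u3 p * v1 p"
    and "m14 \<equiv> \<lambda>p. u1 p * v4 p - u4 p * v1 p" and "m23 \<equiv> \<lambda>p. u2 p * v3 p - u3 p * v2 p"
    and "m24 \<equiv> \<lambda>p. u2 p * v4 p - u4 p * v2 p" and "m34 \<equiv> \<lambda>p. u3 p * v4 p - u4 p * v3 p"
  shows "bracket U V = comb
    (\<lambda>p. U p v1 - V p u1 - r * m12 p - \<alpha> * m13 p + \<beta> * m23 p - a * m14 p + b * m24 p)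
    (\<lambda>p. U p v2 - V p u2 - \<beta> * m13 p - \<alpha> * m23 p - b * m14 p - a * m24 p)
    (\<lambda>p. U p v3 - V p u3 - \<theta>1 * m12 p - z1 * m13 p - z3 * m14 p - z2 * m23 p - z4 * m24 p)
    (\<lambda>p. U p v4 - V p u4 - \<theta>2 * m12 p - w1 * m13 p - w2 * m23 p + z1 * m14 p + z2 * m24 p - lam * m34 p)"
  unfolding fun_eq_iff bracket_comb[OF u v U V]
  by (simp add: comb_apply bracket_frame scaleR_fun_def m12_def m13_def m14_def m23_def m24_def m34_def
      algebra_simps)

text \<open>The relations \<open>N(V,U) = - N(U,V)\<close> and \<open>N(JU,V) = - J N(U,V)\<close> reduce all values of \<open>N\<close> to
  \<open>N(X,Z) = - (2 z1 - z4 - w2) Z - (2 z2 + z3 + w1) W\<close>. The functions \<open>P\<close> and \<open>Q\<close> collect the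
  coefficients of \<open>N(X,Z)\<close> and of \<open>N(X,W) = - J N(X,Z)\<close>: the pair \<open>(Y,W) = (JX,JZ)\<close> contributes
  \<open>- N(X,Z)\<close>, and \<open>(Y,Z) = (JX,Z)\<close> contributes the same as \<open>(X,W)\<close>.\<close>

lemma nijenhuis_comb:
  assumes u: "smooth_fun A u1" "smooth_fun A u2" "smooth_fun A u3" "smooth_fun A u4"
    and v: "smooth_fun A v1" "smooth_fun A v2" "smooth_fun A v3" "smooth_fun A v4"
  defines "P \<equiv> \<lambda>p. u1 p * v3 p - u3 p * v1 p - (u2 p * v4 p - u4 p * v2 p)"
    and "Q \<equiv> \<lambda>p. u1 p * v4 p - u4 p * v1 p + (u2 p * v3 p - u3 p * v2 p)"
  shows "nijenhuis J (comb u1 u2 u3 u4) (comb v1 v2 v3 v4) = comb (\<lambda>_. 0) (\<lambda>_. 0)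
    (\<lambda>p. - (2 * z1 - z4 - w2) * P p - (2 * z2 + z3 + w1) * Q p)
    (\<lambda>p. - (2 * z2 + z3 + w1) * P p + (2 * z1 - z4 - w2) * Q p)"
proof -
  note um = smooth_fun_uminus[OF atlas]
  note ju = um[OF u(2)] u(1) um[OF u(4)] u(3)
  note jv = um[OF v(2)] v(1) um[OF v(4)] v(3)
  note minus = tvec_uminus[OF atlas comb_tangent]
  show ?thesis
    unfolding nijenhuis_def J_comb bracket_comb_structure_constants[OF u v refl refl]
      bracket_comb_structure_constants[OF ju v refl refl] bracket_comb_structure_constants[OF u jv refl refl]
      bracket_comb_structure_constants[OF ju jv refl refl]
    unfolding comb_add comb_diff
    by (rule comb_cong) (simp_all add: minus u v P_def Q_def algebra_simps)
qed

lemma integrable_iff: "integrable_acs A J \<longleftrightarrow> 2 * z2 + z3 + w1 = 0 \<and> 2 * z1 - z4 - w2 = 0"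
proof
  assume "integrable_acs A J"
  then have "nijenhuis J X Z = 0"
    using vector_field_frame by (simp add: integrable_acs_def)
  then have N: "comb (\<lambda>_. 0) (\<lambda>_. 0) (\<lambda>_. - (2 * z1 - z4 - w2)) (\<lambda>_. - (2 * z2 + z3 + w1)) = 0"
    using nijenhuis_comb[OF smooth_fun_const smooth_fun_const smooth_fun_const smooth_fun_const
        smooth_fun_const smooth_fun_const smooth_fun_const smooth_fun_const, of 1 0 0 0 0 0 1 0]
    by (simp flip: frame_as_comb)
  have "g undefined (comb (\<lambda>_. 0) (\<lambda>_. 0) (\<lambda>_. - (2 * z1 - z4 - w2)) (\<lambda>_. - (2 * z2 + z3 + w1)) undefined) v
      = g undefined (comb (\<lambda>_. 0) (\<lambda>_. 0) (\<lambda>_. 0) (\<lambda>_. 0) undefined) v" for v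
    unfolding N comb_zero ..
  from this[of "Z undefined"] this[of "W undefined"]
  show "2 * z2 + z3 + w1 = 0 \<and> 2 * z1 - z4 - w2 = 0"
    by (simp add: metric_comb frame_tangent)
next
  assume *: "2 * z2 + z3 + w1 = 0 \<and> 2 * z1 - z4 - w2 = 0"
  show "integrable_acs A J"
    unfolding integrable_acs_def
  proof (intro allI impI)
    fix U V assume "vector_field A U" "vector_field A V"
    then show "nijenhuis J U V = 0"
      using * by (auto elim!: vector_field_cases simp: nijenhuis_comb comb_apply fun_eq_iff)
  qed
qed

text \<open>The components of \<open>d\<omega>\<close> on \<open>(X,Z,W)\<close> and \<open>(Y,Z,W)\<close> vanish: the contributions of \<open>z1\<close>
  respectively \<open>z2\<close> cancel, because both coefficients occur twice with opposite signs in the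
  bracket relations, and \<open>[W,Z]\<close> has no component that pairs with \<open>X\<close> or \<open>Y\<close> under
  \<open>\<omega>\<close>. The remaining components on \<open>(X,Y,W)\<close> and \<open>(X,Y,Z)\<close> are multiplied by the
  corresponding minors \<open>D\<close> of the coefficient matrix.\<close>

lemma ext_deriv2_comb:
  assumes u: "smooth_fun A u1" "smooth_fun A u2" "smooth_fun A u3" "smooth_fun A u4"
    and v: "smooth_fun A v1" "smooth_fun A v2" "smooth_fun A v3" "smooth_fun A v4"
    and x: "smooth_fun A x1" "smooth_fun A x2" "smooth_fun A x3" "smooth_fun A x4"
  defines "D \<equiv> \<lambda>s1 s2 s3 t1 t2 t3 r1 r2 r3 (p::'g).
    s1 p * (t2 p * r3 p - t3 p * r2 p) - s2 p * (t1 p * r3 p - t3 p * r1 p)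
    + s3 p * (t1 p * r2 p - t2 p * r1 p) :: real"
  shows "ext_deriv2 (kaehler_form g J) (comb u1 u2 u3 u4) (comb v1 v2 v3 v4) (comb x1 x2 x3 x4) p =
    (\<theta>1 - 2 * a) * D u1 u2 u4 v1 v2 v4 x1 x2 x4 p - (\<theta>2 + 2 * \<alpha>) * D u1 u2 u3 v1 v2 v3 x1 x2 x3 p"
proof -
  have deriv: "comb t1 t2 t3 t4 p (\<lambda>q. r1 q * s2 q - r2 q * s1 q + (r3 q * s4 q - r4 q * s3 q)) =
      (comb t1 t2 t3 t4 p r1 * s2 p + r1 p * comb t1 t2 t3 t4 p s2)
      - (comb t1 t2 t3 t4 p r2 * s1 p + r2 p * comb t1 t2 t3 t4 p s1)
      + ((comb t1 t2 t3 t4 p r3 * s4 p + r3 p * comb t1 t2 t3 t4 p s4)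
      - (comb t1 t2 t3 t4 p r4 * s3 p + r4 p * comb t1 t2 t3 t4 p s3))"
    if "smooth_fun A r1" "smooth_fun A r2" "smooth_fun A r3" "smooth_fun A r4"
      "smooth_fun A s1" "smooth_fun A s2" "smooth_fun A s3" "smooth_fun A s4" for t1 t2 t3 t4 r1 r2 r3 r4 s1 s2 s3 s4
    by (simp add: that tvec_add[OF atlas comb_tangent] tvec_diff[OF atlas comb_tangent]
        tvec_mult[OF atlas comb_tangent] smooth_fun_add[OF atlas] smooth_fun_diff[OF atlas]
        smooth_fun_mult[OF atlas])
  show ?thesis
    unfolding ext_deriv2_def bracket_comb_structure_constants[OF u v refl refl]
      bracket_comb_structure_constants[OF u x refl refl] bracket_comb_structure_constants[OF v x refl refl] kaehler_form_comb
      deriv[OF u v] deriv[OF u x] deriv[OF v x] D_def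
    by algebra
qed

lemma almost_kaehler_iff: "almost_kaehler A g J \<longleftrightarrow> \<theta>1 - 2 * a = 0 \<and> \<theta>2 + 2 * \<alpha> = 0"
proof
  assume *: "almost_kaehler A g J"
  note c = smooth_fun_const
  have "ext_deriv2 (kaehler_form g J) X Y W = 0" "ext_deriv2 (kaehler_form g J) X Y Z = 0"
    using * vector_field_frame by (simp_all add: almost_kaehler_def)
  then show "\<theta>1 - 2 * a = 0 \<and> \<theta>2 + 2 * \<alpha> = 0"
    using ext_deriv2_comb[OF c c c c c c c c c c c c, of 1 0 0 0 0 1 0 0 0 0 0 1]
      ext_deriv2_comb[OF c c c c c c c c c c c c, of 1 0 0 0 0 1 0 0 0 0 1 0]
    by (simp flip: frame_as_comb)
next
  assume *: "\<theta>1 - 2 * a = 0 \<and> \<theta>2 + 2 * \<alpha> = 0"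
  show "almost_kaehler A g J"
    unfolding almost_kaehler_def
  proof (intro allI impI)
    fix U V E assume "vector_field A U" "vector_field A V" "vector_field A E"
    then show "ext_deriv2 (kaehler_form g J) U V E = 0"
      using * by (auto elim!: vector_field_cases simp: ext_deriv2_comb fun_eq_iff)
  qed
qed

end

section \<open>Almost Hermitian Lie groups of dimension four\<close>

theorem mainTheorem2:
  fixes A :: "('g::{t2_space, second_countable_topology}, real ^ 4) atlas"
    and mul :: "'g \<Rightarrow> 'g \<Rightarrow> 'g" and e :: 'g and minv :: "'g \<Rightarrow> 'g"
    and g :: "'g \<Rightarrow> 'g tvec \<Rightarrow> 'g tvec \<Rightarrow> real"
    and J :: "'g \<Rightarrow> 'g tvec \<Rightarrow> 'g tvec"
    and X Y Z W :: "'g vfield"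
    and lam \<alpha> \<beta> a b r z1 z2 z3 z4 w1 w2 \<theta>1 \<theta>2 :: real
  assumes "lie_group A mul e minv"
    and "riemannian_metric A g" and "left_invariant_metric A mul g"
    and "orthonormal_basis g (lie_algebra A mul) [X, Y, Z, W]"
    and "bracket W Z = lam *\<^sub>R W"
    and "bracket Z X = \<alpha> *\<^sub>R X + \<beta> *\<^sub>R Y + z1 *\<^sub>R Z + w1 *\<^sub>R W"
    and "bracket Z Y = - \<beta> *\<^sub>R X + \<alpha> *\<^sub>R Y + z2 *\<^sub>R Z + w2 *\<^sub>R W"
    and "bracket W X = a *\<^sub>R X + b *\<^sub>R Y + z3 *\<^sub>R Z - z1 *\<^sub>R W"
    and "bracket W Y = - b *\<^sub>R X + a *\<^sub>R Y + z4 *\<^sub>R Z - z2 *\<^sub>R W"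
    and "bracket Y X = r *\<^sub>R X + \<theta>1 *\<^sub>R Z + \<theta>2 *\<^sub>R W"
    and "almost_complex A J" and "left_invariant_endo A mul J"
    and "app_field J X = Y" and "app_field J Y = - X"
    and "app_field J Z = W" and "app_field J W = - Z"
  shows "(integrable_acs A J \<longleftrightarrow> 2 * z2 + z3 + w1 = 0 \<and> 2 * z1 - z4 - w2 = 0) \<and>
    (almost_kaehler A g J \<longleftrightarrow> \<theta>1 - 2 * a = 0 \<and> \<theta>2 + 2 * \<alpha> = 0) \<and>
    (kaehler A g J \<longleftrightarrow>
       (\<theta>1 - 2 * a = 0 \<and> \<theta>2 + 2 * \<alpha> = 0) \<and>
       (2 * z2 + z3 + w1 = 0 \<and> 2 * z1 - z4 - w2 = 0))"
proof -
  have L: "set [X, Y, Z, W] \<subseteq> lie_algebra A mul"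
    using assms(4) span_superset[of "set [X, Y, Z, W]"] by (simp only: orthonormal_basis_def)
  interpret lie_frame A g X Y Z W J lam \<alpha> \<beta> a b r z1 z2 z3 z4 w1 w2 \<theta>1 \<theta>2
  proof
    show "smooth_atlas A" using assms(1) by (simp add: lie_group_def)
    show "vector_field A X" "vector_field A Y" "vector_field A Z" "vector_field A W"
      using L by (simp_all add: lie_algebra_def)
    show "g p (([X, Y, Z, W] ! i) p) (([X, Y, Z, W] ! j) p) = (if i = j then 1 else 0)"
      if "i < 4" "j < 4" for i j p
      using assms(4) that by (simp add: orthonormal_basis_def)
  qed (fact assms)+
  show ?thesis
    using integrable_iff almost_kaehler_iff by (simp add: kaehler_def)
qed

end
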